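(* There exists a family of total Boolean functions $f_m:\{0,1\}^{m^2}\to\{0,1\}$ (for positive integers $m$) such that 1. $\mathrm{rdeg}(f_m)=m$; 2. $\mathrm{deg}^{\mathsf{cert}}(f_m)\ge\widetilde{\Omega}\left(m^{3/2}\right)$, where $\widetilde\Omega$ hides factors polylogarithmic in $m$.
   Context: For a (possibly partial) Boolean function $f:\mathcal{D}\subseteq\{0,1\}^n\to\{0,1\}$ and $z\in\mathcal{D}$, $f^{\mathsf{cert}}_z$ is the partial function with domain $\{z\}\cup\{y\in\mathcal{D}: f(y)\ne f(z)\}$, with $f^{\mathsf{cert}}_z(z)=1$ and $f^{\mathsf{cert}}_z(y)=0$ whenever $f(y)\neq f(z)$. For a complexity measure $\mathsf{M}$, $\mathsf{M}^{\mathsf{cert}}(f):=\max_{z\in\mathcal{D}}\mathsf{M}(f^{\mathsf{cert}}_z)$. For a (possibly partial) Boolean function $f$ with domain $\mathcal{D}\subseteq\{0,1\}^n$, $\mathrm{deg}(f)$ is the minimum degree of a multilinear real polynomial $P$ with $P(x)=f(x)$ for all $x\in\mathcal{D}$ and $P(x)\in[0,1]$ for all $x\in\{0,1\}^n$. $\mathrm{rdeg}(f)$ (rational degree) is the minimum of $\max\{\deg(P),\deg(Q)\}$ over real polynomials $P,Q$ with $Q(x)\ne 0$ and $P(x)/Q(x)=f(x)$ for all $x\in\mathcal{D}$. *)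

theory Defs
  imports Complex_Main "HOL-Library.FuncSet" "HOL-Library.Poly_Mapping"
    "HOL-Library.Landau_Symbols"
begin

definition cube :: "nat \<Rightarrow> (nat \<Rightarrow> bool) set" where
  "cube n = ({..<n} \<rightarrow>\<^sub>E UNIV)"

text \<open>
  A polynomial is a finitely supported map from monomials to coefficients, where a monomial is a
  finitely supported map from variable indices to exponents.
\<close>
type_synonym rpoly = "(nat \<Rightarrow>\<^sub>0 nat) \<Rightarrow>\<^sub>0 real"

definition poly_vars :: "rpoly \<Rightarrow> nat set" where
  "poly_vars P = (\<Union>m\<in>Poly_Mapping.keys P. Poly_Mapping.keys m)"

definition poly_eval :: "rpoly \<Rightarrow> (nat \<Rightarrow> real) \<Rightarrow> real" where
  "poly_eval P x = (\<Sum>m\<in>Poly_Mapping.keys P. Poly_Mapping.lookup P m *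
     (\<Prod>i\<in>Poly_Mapping.keys m. x i ^ Poly_Mapping.lookup m i))"

abbreviation eval_at :: "rpoly \<Rightarrow> (nat \<Rightarrow> bool) \<Rightarrow> real" where
  "eval_at P x \<equiv> poly_eval P (\<lambda>i. of_bool (x i))"

text \<open>The zero polynomial gets degree 0.\<close>
definition total_degree :: "rpoly \<Rightarrow> nat" where
  "total_degree P = Max (insert 0
     ((\<lambda>m. \<Sum>i\<in>Poly_Mapping.keys m. Poly_Mapping.lookup m i) ` Poly_Mapping.keys P))"

definition multilinear :: "rpoly \<Rightarrow> bool" where
  "multilinear P \<longleftrightarrow> (\<forall>m\<in>Poly_Mapping.keys P. \<forall>i. Poly_Mapping.lookup m i \<le> 1)"

text \<open>
  A possibly partial Boolean function on \<open>n\<close> variables is a map \<open>f\<close> with \<open>dom f \<subseteq> cube n\<close>; it is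
  total if \<open>dom f = cube n\<close>. For such \<open>f\<close> the minima in the next two definitions range over
  nonempty sets, since every real function on the cube is given by a multilinear polynomial.
\<close>
definition bdeg :: "nat \<Rightarrow> ((nat \<Rightarrow> bool) \<rightharpoonup> bool) \<Rightarrow> nat" where
  "bdeg n f = (LEAST d. \<exists>P. poly_vars P \<subseteq> {..<n} \<and> multilinear P \<and> total_degree P = d \<and>
     (\<forall>x\<in>dom f. eval_at P x = of_bool (the (f x))) \<and>
     (\<forall>x\<in>cube n. eval_at P x \<in> {0..1}))"

definition rdeg :: "nat \<Rightarrow> ((nat \<Rightarrow> bool) \<rightharpoonup> bool) \<Rightarrow> nat" where
  "rdeg n f = (LEAST d. \<exists>P Q. poly_vars P \<subseteq> {..<n} \<and> poly_vars Q \<subseteq> {..<n} \<and>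
     max (total_degree P) (total_degree Q) = d \<and>
     (\<forall>x\<in>dom f. eval_at Q x \<noteq> 0 \<and> eval_at P x / eval_at Q x = of_bool (the (f x))))"

definition cert_fun :: "('a \<rightharpoonup> bool) \<Rightarrow> 'a \<Rightarrow> ('a \<rightharpoonup> bool)" where
  "cert_fun f z = (\<lambda>y. if y = z then Some True
     else if y \<in> dom f \<and> f y \<noteq> f z then Some False else None)"

definition cert_measure :: "(('a \<rightharpoonup> bool) \<Rightarrow> nat) \<Rightarrow> ('a \<rightharpoonup> bool) \<Rightarrow> nat" where
  "cert_measure M f = Max ((\<lambda>z. M (cert_fun f z)) ` dom f)"

end

theory Submission
  imports Defs "HOL-Complex_Analysis.Complex_Analysis" "HOL-Real_Asymp.Real_Asymp"
begin

text \<open>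
  View an input as an \<open>m\<close> by \<open>m\<close> matrix and let \<open>f x\<close> say that no row contains exactly one \<open>1\<close>. The
  product over the rows of (row weight - 1) vanishes exactly where \<open>f\<close> is false, and the number of
  rows of weight one vanishes exactly where \<open>f\<close> is true; both have degree at most \<open>m\<close>, and a
  quotient of them computes \<open>f\<close>.

  For the certificate at the zero input, average a bounded polynomial of degree \<open>D\<close> over independent
  entries of bias \<open>s\<close>. The resulting univariate polynomial \<open>p\<close> satisfies \<open>p 0 = 1\<close> and
  \<open>0 \<le> p \<le> 1\<close> on the unit interval, but it is exponentially small in \<open>m\<close> when \<open>s\<close> is of order
  \<open>1 / m\<close>, as then almost surely some row has weight one. After the substitution
  \<open>s = sin\<^sup>2 (\<theta> / 2)\<close> it is a trigonometric polynomial with bounded coefficients and frequencies at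
  most \<open>D\<close>. Extrapolating it to \<open>\<theta> = 0\<close> from about \<open>m\<close> equidistant points with \<open>\<theta>\<close> of order
  \<open>1 / sqrt m\<close> gives a contradiction unless \<open>D\<close> times the spacing \<open>m powr (- 3/2)\<close> is bounded below.
\<close>

section \<open>Extrapolation of bounded polynomials\<close>

text \<open>Cauchy's estimate for the \<open>k\<close>-th derivative at 0. It turns a bound on the
  unit circle into the coefficient bound that \<open>trig_sum_at_0_le\<close> asks for.\<close>

lemma norm_coeff_le_if_bounded_on_circle:
  fixes q :: "complex poly"
  assumes "\<And>z. norm z = 1 \<Longrightarrow> norm (poly q z) \<le> B"
  shows "norm (coeff q k) \<le> B"
proof -
  have d: "(deriv ^^ k) (poly q) = poly ((pderiv ^^ k) q)"
    by (induction k) (auto intro!: DERIV_imp_deriv poly_DERIV)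
  have "poly ((pderiv ^^ k) q) 0 = fact k * coeff q k"
    by (simp add: poly_0_coeff_0 coeff_higher_pderiv pochhammer_fact)
  moreover have "norm ((deriv ^^ k) (poly q) 0) \<le> fact k * B / 1 ^ k"
    using assms by (intro Cauchy_inequality) (auto intro!: holomorphic_intros continuous_intros)
  ultimately have "fact k * norm (coeff q k) \<le> fact k * B"
    by (simp add: d norm_mult)
  then show ?thesis by simp
qed

text \<open>By the mean value theorem \<open>sin x = x * cos z\<close> with
  \<open>z < pi / 3\<close>, where the cosine is at least \<open>1/2\<close>. This keeps the
  extrapolation nodes away from 0.\<close>

lemma half_le_sin: "x / 2 \<le> sin x" if "0 \<le> x" "x \<le> 1" for x :: real
proof (cases "x = 0")
  case False
  then have "0 < x" using that by simp
  then obtain z where z: "0 < z" "z < x" "sin x - sin 0 = (x - 0) * cos z"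
    using MVT2[of 0 x sin cos] by auto
  have "z \<le> pi / 3" using z that pi_gt3 by linarith
  then have "cos (pi / 3) \<le> cos z"
    using z pi_gt3 by (intro cos_monotone_0_pi_le) auto
  then have "x * (1 / 2) \<le> x * cos z"
    using \<open>0 < x\<close> by (intro mult_left_mono) (auto simp: cos_60)
  with z show ?thesis by simp
qed simp

lemma norm_one_minus_cis_le: "norm (1 - cis x) \<le> \<bar>x\<bar>"
proof -
  have "norm (1 - cis x) = 2 * \<bar>sin (x / 2)\<bar>"
    using dist_exp_i_1[of x] by (simp add: cis_conv_exp norm_minus_commute)
  also have "\<dots> \<le> 2 * \<bar>x / 2\<bar>"
    by (intro mult_left_mono abs_sin_x_le_abs_x) auto
  finally show ?thesis by simp
qed

text \<open>
  The identity \<open>1 = (z + (1 - z)) ^ (2 * N)\<close> is applied to the shift operator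
  \<open>T(\<theta>) \<mapsto> T(\<theta> + h)\<close>: the terms with many factors \<open>1 - z\<close> are small because \<open>T\<close> has low frequencies,
  the other ones only involve the values \<open>T(j * h)\<close> with \<open>N < j \<le> 2 * N\<close>.
\<close>
lemma trig_sum_at_0_le:
  fixes a :: "nat \<Rightarrow> complex" and D N :: nat and h \<epsilon> :: real
  defines "T \<equiv> \<lambda>\<theta>. \<Sum>k\<le>2*D. a k * cis ((real k - real D) * \<theta>)"
  assumes a: "\<And>k. norm (a k) \<le> 1" and h: "0 \<le> h" "real D * h \<le> 1"
    and T: "\<And>j. N < j \<Longrightarrow> j \<le> 2 * N \<Longrightarrow> norm (T (real j * h)) \<le> \<epsilon>"
    and e: "0 \<le> \<epsilon>"
  shows "norm (T 0) \<le> real (2 * D + 1) * (4 * real D * h) ^ N + 9 ^ N * \<epsilon>"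
proof -
  define M where "M = 2 * N"
  define z where "z = (\<lambda>k::nat. cis ((real k - real D) * h))"
  define t where "t = (\<lambda>i (z::complex). of_nat (M choose i) * z ^ i * (1 - z) ^ (M - i))"
  define G where "G = (\<lambda>z. \<Sum>i\<le>N. t i z)"
  define R where "R = (\<lambda>z. \<Sum>i\<in>{N<..M}. t i z)"
  have GR: "G w + R w = 1" for w
  proof -
    have "(\<Sum>i\<le>M. t i w) = (w + (1 - w)) ^ M"
      unfolding t_def by (subst binomial_ring) simp
    moreover have "{..M} = {..N} \<union> {N<..M}" by (auto simp: M_def)
    ultimately show ?thesis
      unfolding G_def R_def by (simp add: sum.union_disjoint Int_def)
  qed
  have zpow: "z k ^ j = cis ((real k - real D) * (real j * h))" for k j
    by (simp add: z_def Complex.DeMoivre algebra_simps)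
  have nz: "norm (z k) = 1" for k by (simp add: z_def)
  \<comment> \<open>A term with \<open>i \<le> N\<close> keeps at least \<open>N\<close> factors
    \<open>1 - z k\<close>, each of norm at most \<open>D * h \<le> 1\<close>; the binomial
    coefficients add up to \<open>2 ^ M = 4 ^ N\<close>.\<close>
  have Gb: "norm (G (z k)) \<le> (4 * real D * h) ^ N" if "k \<le> 2 * D" for k
  proof -
    have "\<bar>real k - real D\<bar> \<le> real D" using that by linarith
    then have "\<bar>(real k - real D) * h\<bar> \<le> real D * h"
      using h by (simp add: abs_mult mult_right_mono)
    then have 1: "norm (1 - z k) \<le> real D * h"
      unfolding z_def using norm_one_minus_cis_le order_trans by blast
    have "norm (t i (z k)) \<le> real (M choose i) * (real D * h) ^ N" if "i \<le> N" for i
    proof -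
      have "norm (1 - z k) ^ (M - i) \<le> (real D * h) ^ (M - i)"
        using 1 by (intro power_mono) auto
      also have "\<dots> \<le> (real D * h) ^ N"
        using h that by (intro power_decreasing) (auto simp: M_def)
      finally show ?thesis
        by (simp add: t_def norm_mult norm_power nz mult_left_mono)
    qed
    then have "norm (G (z k)) \<le> (\<Sum>i\<le>N. real (M choose i) * (real D * h) ^ N)"
      unfolding G_def by (intro sum_norm_le) auto
    also have "\<dots> \<le> (\<Sum>i\<le>M. real (M choose i) * (real D * h) ^ N)"
      using h by (intro sum_mono2) (auto simp: M_def)
    also have "\<dots> = real (\<Sum>i\<le>M. M choose i) * (real D * h) ^ N"
      by (simp add: sum_distrib_right)
    also have "\<dots> = (4 * real D * h) ^ N"
      by (simp add: choose_row_sum M_def power_mult power_mult_distrib)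
    finally show ?thesis .
  qed
  \<comment> \<open>Multiplying each \<open>a k\<close> by \<open>z k\<close> shifts the argument of
    \<open>T\<close> by \<open>h\<close>. For \<open>i > N\<close> the total shifts
    \<open>i + l\<close> stay between \<open>N + 1\<close> and \<open>M\<close>, where
    \<open>T\<close> is at most \<open>\<epsilon>\<close>.\<close>
  have tT: "(\<Sum>k\<le>2*D. a k * t i (z k)) =
      of_nat (M choose i) * (\<Sum>l\<le>M-i. of_nat ((M - i) choose l) * (-1) ^ l * T (real (i + l) * h))" for i
  proof -
    have "a k * t i (z k) = (\<Sum>l\<le>M-i. of_nat (M choose i) * (of_nat ((M - i) choose l) * (-1) ^ l *
        (a k * z k ^ (i + l))))" for k
    proof -
      have "(1 - z k) ^ (M - i) = (\<Sum>l\<le>M-i. of_nat ((M - i) choose l) * (-1) ^ l * z k ^ l)"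
        using binomial_ring[of "- z k" 1 "M - i"]
        by (simp add: power_minus[of "z k"] mult.assoc)
      then show ?thesis
        by (simp add: t_def sum_distrib_left sum_distrib_right power_add mult_ac)
    qed
    then show ?thesis
      unfolding T_def zpow[symmetric] sum_distrib_left
      by (subst sum.swap) (simp add: zpow algebra_simps)
  qed
  have Rb: "norm (\<Sum>k\<le>2*D. a k * t i (z k)) \<le> real (M choose i) * 2 ^ (M - i) * \<epsilon>"
    if i: "i \<in> {N<..M}" for i
  proof -
    have "norm (\<Sum>l\<le>M-i. of_nat ((M - i) choose l) * (-1) ^ l * T (real (i + l) * h))
        \<le> (\<Sum>l\<le>M-i. real ((M - i) choose l) * \<epsilon>)"
      using i T by (intro sum_norm_le)
        (auto simp: norm_mult norm_power M_def simp del: of_nat_add intro!: mult_left_mono)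
    also have "\<dots> = real (\<Sum>l\<le>M-i. (M - i) choose l) * \<epsilon>"
      by (simp add: sum_distrib_right)
    also have "\<dots> = 2 ^ (M - i) * \<epsilon>"
      by (simp add: choose_row_sum)
    finally show ?thesis
      unfolding tT by (simp add: norm_mult mult_left_mono mult.assoc)
  qed
  have "T 0 = (\<Sum>k\<le>2*D. a k * (G (z k) + R (z k)))"
    by (simp add: T_def GR)
  also have "\<dots> = (\<Sum>k\<le>2*D. a k * G (z k)) + (\<Sum>i\<in>{N<..M}. \<Sum>k\<le>2*D. a k * t i (z k))"
    unfolding R_def by (simp add: distrib_left sum.distrib sum_distrib_left sum.swap[of _ "{N<..M}"])
  also have "norm \<dots> \<le> (\<Sum>k\<le>2*D. (4 * real D * h) ^ N) + (\<Sum>i\<in>{N<..M}. real (M choose i) * 2 ^ (M - i) * \<epsilon>)"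
  proof (intro norm_triangle_mono sum_norm_le Rb)
    fix k assume "k \<in> {..2*D}"
    then have "norm (a k) * norm (G (z k)) \<le> 1 * (4 * real D * h) ^ N"
      using a Gb by (intro mult_mono) auto
    then show "norm (a k * G (z k)) \<le> (4 * real D * h) ^ N"
      by (simp add: norm_mult)
  qed
  \<comment> \<open>Extending the sum to all \<open>i\<close> completes the expansion of
    \<open>(1 + 2) ^ M\<close>, the source of \<open>9 ^ N\<close>.\<close>
  also have "(\<Sum>i\<in>{N<..M}. real (M choose i) * 2 ^ (M - i) * \<epsilon>) \<le>
      (\<Sum>i\<le>M. real (M choose i) * 1 ^ i * 2 ^ (M - i) * \<epsilon>)"
    using e by (simp, intro sum_mono2) auto
  also have "\<dots> = (1 + 2) ^ M * \<epsilon>"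
    by (subst binomial_ring) (simp add: sum_distrib_right)
  also have "\<dots> = 9 ^ N * \<epsilon>"
    by (simp add: M_def power_mult)
  finally show ?thesis by simp
qed

lemma poly_eq_sum_atMost:
  fixes p :: "'a::comm_semiring_1 poly"
  assumes "Polynomial.degree p \<le> D"
  shows "poly p x = (\<Sum>k\<le>D. coeff p k * x ^ k)"
  unfolding poly_altdef using assms
  by (intro sum.mono_neutral_left) (auto simp: coeff_eq_0)

text \<open>For \<open>w = cis \<theta>\<close>, the product of \<open>w\<close> and
  \<open>(sin (\<theta> / 2))\<^sup>2\<close> is the quadratic \<open>-1/4 + w/2 - w^2/4\<close>.
  Hence \<open>w ^ D\<close> times the value of \<open>p\<close> at the squared sine is a polynomial
  \<open>q\<close> in \<open>w\<close> of degree at most \<open>2 * D\<close>. It has modulus at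
  most 1 on the circle, so its coefficients are bounded by 1, and dividing by \<open>w ^ D\<close>
  gives the trigonometric sum.\<close>

lemma poly_at_0_le:
  fixes p :: "real poly" and D N :: nat and h \<epsilon> :: real
  assumes deg: "Polynomial.degree p \<le> D"
    and bnd: "\<And>s. 0 \<le> s \<Longrightarrow> s \<le> 1 \<Longrightarrow> \<bar>poly p s\<bar> \<le> 1"
    and h: "0 \<le> h" "real D * h \<le> 1"
    and small: "\<And>j. N < j \<Longrightarrow> j \<le> 2 * N \<Longrightarrow> \<bar>poly p ((sin (real j * h / 2))\<^sup>2)\<bar> \<le> \<epsilon>"
    and e: "0 \<le> \<epsilon>"
  shows "\<bar>poly p 0\<bar> \<le> real (2 * D + 1) * (4 * real D * h) ^ N + 9 ^ N * \<epsilon>"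
proof -
  \<comment> \<open>The \<open>r\<close>-th power of the quadratic carries only
    \<open>w ^ r\<close>; the monomial of degree \<open>D - r\<close> raises this to the common
    factor \<open>w ^ D\<close>.\<close>
  define q :: "complex poly" where
    "q = (\<Sum>r\<le>D. smult (of_real (coeff p r)) (monom 1 (D - r) * [:-1/4, 1/2, -1/4:] ^ r))"
  define T where "T = (\<lambda>\<theta>. \<Sum>k\<le>2*D. coeff q k * cis ((real k - real D) * \<theta>))"
  have key: "poly [:-1/4, 1/2, -1/4:] (cis \<theta>) = cis \<theta> * of_real ((sin (\<theta> / 2))\<^sup>2)" for \<theta>
  proof -
    have c: "cos \<theta> = 1 - 2 * (sin (\<theta> / 2))\<^sup>2" "sin \<theta> = 2 * sin (\<theta> / 2) * cos (\<theta> / 2)"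
      using cos_double_sin[of "\<theta> / 2"] sin_double[of "\<theta> / 2"] by auto
    have s: "(cos (\<theta> / 2))\<^sup>2 = 1 - (sin (\<theta> / 2))\<^sup>2" by (simp add: cos_squared_eq)
    show ?thesis
      unfolding complex_eq_iff using c s
      by (simp add: power2_eq_square) algebra
  qed
  have qp: "poly q (cis \<theta>) = cis (real D * \<theta>) * of_real (poly p ((sin (\<theta> / 2))\<^sup>2))" for \<theta>
  proof -
    have "poly (monom 1 (D - r) * [:-1/4, 1/2, -1/4:] ^ r) (cis \<theta>) =
        cis \<theta> ^ D * of_real ((sin (\<theta> / 2))\<^sup>2) ^ r" if "r \<le> D" for r
      unfolding poly_mult poly_power key poly_monom power_mult_distrib
      using that by (simp flip: power_add mult.assoc)
    then have "poly q (cis \<theta>) = (\<Sum>r\<le>D. cis \<theta> ^ D * (of_real (coeff p r) * of_real ((sin (\<theta> / 2))\<^sup>2) ^ r))"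
      unfolding q_def poly_sum by (intro sum.cong) (simp_all add: mult_ac)
    then show ?thesis
      unfolding poly_eq_sum_atMost[OF deg]
      by (simp add: Complex.DeMoivre sum_distrib_left)
  qed
  have "Polynomial.degree q \<le> 2 * D"
    unfolding q_def
  proof (intro degree_sum_le)
    fix r assume "r \<in> {..D}"
    have "Polynomial.degree ([:-1/4, 1/2, -1/4::complex:] ^ r) \<le> 2 * r"
      using degree_power_le[of "[:-1/4, 1/2, -1/4::complex:]" r] by simp
    moreover have "Polynomial.degree (monom (1::complex) (D - r)) = D - r"
      by (simp add: degree_monom_eq)
    ultimately have "Polynomial.degree (monom 1 (D - r) * [:-1/4, 1/2, -1/4::complex:] ^ r) \<le> 2 * D"
      using \<open>r \<in> {..D}\<close> by (intro order_trans[OF degree_mult_le]) auto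
    then show "Polynomial.degree (smult (complex_of_real (coeff p r)) (monom 1 (D - r) * [:-1/4, 1/2, -1/4:] ^ r)) \<le> 2 * D"
      using degree_smult_le order_trans by blast
  qed auto
  then have "poly q (cis \<theta>) = cis (real D * \<theta>) * T \<theta>" for \<theta>
    unfolding poly_eq_sum_atMost[OF \<open>Polynomial.degree q \<le> 2 * D\<close>] T_def sum_distrib_left
    by (intro sum.cong) (simp_all add: Complex.DeMoivre cis_mult algebra_simps mult.left_commute[of "cis _"])
  then have Tp: "T \<theta> = of_real (poly p ((sin (\<theta> / 2))\<^sup>2))" for \<theta>
    using qp[of \<theta>] by simp
  have "norm (coeff q k) \<le> 1" for k
  proof (rule norm_coeff_le_if_bounded_on_circle)
    fix w :: complex assume "norm w = 1"
    then have "w = cis (Arg w)" using rcis_cmod_Arg[of w] by (simp add: rcis_def)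
    then obtain \<theta> where "w = cis \<theta>" by blast
    then show "norm (poly q w) \<le> 1"
      using bnd[of "(sin (\<theta> / 2))\<^sup>2"] by (simp add: qp norm_mult abs_square_le_1)
  qed
  then have "norm (T 0) \<le> real (2 * D + 1) * (4 * real D * h) ^ N + 9 ^ N * \<epsilon>"
    unfolding T_def using h e small Tp[unfolded T_def] by (intro trig_sum_at_0_le) auto
  then show ?thesis by (simp add: Tp)
qed

section \<open>Functions of low degree on the cube\<close>

text \<open>A multilinear form stored by its coefficients on index sets, so that exponents
  disappear. The equation is demanded for every \<open>x\<close>, also outside
  \<open>cube n\<close>, which makes it an identity of functions.\<close>

definition low_degree :: "nat \<Rightarrow> nat \<Rightarrow> ((nat \<Rightarrow> bool) \<Rightarrow> real) \<Rightarrow> bool" where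
  "low_degree n d F \<longleftrightarrow>
     (\<exists>c. \<forall>x. F x = (\<Sum>S | S \<subseteq> {..<n} \<and> card S \<le> d. c S * of_bool (\<forall>i\<in>S. x i)))"

lemma finite_low_sets [simp]: "finite {S. S \<subseteq> {..<n::nat} \<and> card S \<le> d}"
  by (rule finite_subset[of _ "Pow {..<n}"]) auto

lemma low_degree_monomial:
  assumes "S \<subseteq> {..<n}" "card S \<le> d"
  shows "low_degree n d (\<lambda>x. of_bool (\<forall>i\<in>S. x i))"
proof -
  have "of_bool (\<forall>i\<in>S. x i) = (\<Sum>U | U \<subseteq> {..<n} \<and> card U \<le> d. of_bool (U = S) * (of_bool (\<forall>i\<in>U. x i) :: real))" for x
    using assms by (subst sum.remove[of _ S]) (auto intro!: sum.neutral)
  then show ?thesis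
    unfolding low_degree_def by (intro exI[of _ "\<lambda>U. of_bool (U = S)"] allI)
qed

lemma low_degree_add:
  assumes "low_degree n d F" "low_degree n d G"
  shows "low_degree n d (\<lambda>x. F x + G x)"
proof -
  obtain a b where "\<And>x. F x = (\<Sum>S | S \<subseteq> {..<n} \<and> card S \<le> d. a S * of_bool (\<forall>i\<in>S. x i))"
    "\<And>x. G x = (\<Sum>S | S \<subseteq> {..<n} \<and> card S \<le> d. b S * of_bool (\<forall>i\<in>S. x i))"
    using assms unfolding low_degree_def by blast
  then show ?thesis
    unfolding low_degree_def
    by (intro exI[of _ "\<lambda>S. a S + b S"]) (simp add: distrib_right sum.distrib)
qed

lemma low_degree_cmult:
  assumes "low_degree n d F"
  shows "low_degree n d (\<lambda>x. k * F x)"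
proof -
  obtain a where "\<And>x. F x = (\<Sum>S | S \<subseteq> {..<n} \<and> card S \<le> d. a S * of_bool (\<forall>i\<in>S. x i))"
    using assms unfolding low_degree_def by blast
  then show ?thesis
    unfolding low_degree_def
    by (intro exI[of _ "\<lambda>S. k * a S"]) (simp only: sum_distrib_left mult.assoc, simp)
qed

lemma low_degree_const: "low_degree n d (\<lambda>x. k)"
  using low_degree_cmult[OF low_degree_monomial[of "{}" n d], of k] by simp

lemma low_degree_sum:
  assumes "\<And>i. i \<in> A \<Longrightarrow> low_degree n d (F i)"
  shows "low_degree n d (\<lambda>x. \<Sum>i\<in>A. F i x)"
  using assms
  by (induction A rule: infinite_finite_induct) (auto intro: low_degree_const low_degree_add)

lemma low_degree_var: "i < n \<Longrightarrow> low_degree n 1 (\<lambda>x. of_bool (x i))"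
  using low_degree_monomial[of "{i}" n 1] by simp

lemma low_degree_diff:
  assumes "low_degree n d F" "low_degree n d G"
  shows "low_degree n d (\<lambda>x. F x - G x)"
  using low_degree_add[OF assms(1) low_degree_cmult[OF assms(2), of "-1"]] by simp

text \<open>On bits the monomials of \<open>S\<close> and \<open>U\<close> multiply to the monomial
  of \<open>S \<union> U\<close>, whose size is at most \<open>d + e\<close>.\<close>

lemma low_degree_mult:
  assumes "low_degree n d F" "low_degree n e G"
  shows "low_degree n (d + e) (\<lambda>x. F x * G x)"
proof -
  obtain a b where a: "\<And>x. F x = (\<Sum>S | S \<subseteq> {..<n} \<and> card S \<le> d. a S * of_bool (\<forall>i\<in>S. x i))"
    and b: "\<And>x. G x = (\<Sum>S | S \<subseteq> {..<n} \<and> card S \<le> e. b S * of_bool (\<forall>i\<in>S. x i))"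
    using assms unfolding low_degree_def by blast
  have "F x * G x = (\<Sum>S | S \<subseteq> {..<n} \<and> card S \<le> d. \<Sum>U | U \<subseteq> {..<n} \<and> card U \<le> e.
      (a S * b U) * of_bool (\<forall>i\<in>S \<union> U. x i))" for x
    unfolding a b sum_product
    by (intro sum.cong refl) (auto simp: ball_Un of_bool_conj)
  moreover have "low_degree n (d + e) (\<lambda>x. \<Sum>S | S \<subseteq> {..<n} \<and> card S \<le> d. \<Sum>U | U \<subseteq> {..<n} \<and> card U \<le> e.
      (a S * b U) * of_bool (\<forall>i\<in>S \<union> U. x i))"
    by (intro low_degree_sum low_degree_cmult low_degree_monomial)
      (auto intro: order_trans[OF card_Un_le])
  ultimately show ?thesis by simp
qed

lemma low_degree_prod:
  assumes "finite A" "\<And>i. i \<in> A \<Longrightarrow> low_degree n d (F i)"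
  shows "low_degree n (card A * d) (\<lambda>x. \<Prod>i\<in>A. F i x)"
  using assms by (induction A rule: finite_induct)
    (auto simp: add.commute intro!: low_degree_const low_degree_mult[of _ d, simplified add.commute])

text \<open>Positive powers of a bit equal the bit, so only the support of a monomial counts, and
  its size is at most the sum of the exponents.\<close>

lemma low_degree_eval_at:
  assumes "poly_vars P \<subseteq> {..<n}" "total_degree P \<le> d"
  shows "low_degree n d (eval_at P)"
proof -
  have "(\<Prod>i\<in>Poly_Mapping.keys m. of_bool (x i) ^ Poly_Mapping.lookup m i) = (of_bool (\<forall>i\<in>Poly_Mapping.keys m. x i) :: real)"
    for m :: "nat \<Rightarrow>\<^sub>0 nat" and x
  proof (cases "\<forall>i\<in>Poly_Mapping.keys m. x i")
    case False
    then obtain i where "i \<in> Poly_Mapping.keys m" "\<not> x i" by blast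
    then have "(\<Prod>i\<in>Poly_Mapping.keys m. of_bool (x i) ^ Poly_Mapping.lookup m i) = (0::real)"
      by (intro prod_zero) (auto simp: in_keys_iff intro!: bexI[of _ i])
    with False show ?thesis by auto
  qed simp
  then have eq: "eval_at P x = (\<Sum>m\<in>Poly_Mapping.keys P. Poly_Mapping.lookup P m * of_bool (\<forall>i\<in>Poly_Mapping.keys m. x i))" for x
    unfolding poly_eval_def by presburger
  have "low_degree n d (\<lambda>x. of_bool (\<forall>i\<in>Poly_Mapping.keys m. x i))" if m: "m \<in> Poly_Mapping.keys P" for m
  proof (rule low_degree_monomial)
    have "card (Poly_Mapping.keys m) = (\<Sum>i\<in>Poly_Mapping.keys m. 1)" by simp
    also have "\<dots> \<le> (\<Sum>i\<in>Poly_Mapping.keys m. Poly_Mapping.lookup m i)"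
      by (intro sum_mono) (simp add: in_keys_iff)
    also have "\<dots> \<le> total_degree P"
      unfolding total_degree_def using m by (intro Max_ge) auto
    finally show "card (Poly_Mapping.keys m) \<le> d" using assms by simp
    show "Poly_Mapping.keys m \<subseteq> {..<n}"
      using assms m unfolding poly_vars_def by blast
  qed
  then show ?thesis
    unfolding eq by (intro low_degree_sum low_degree_cmult)
qed

text \<open>Each index set becomes the monomial with exponent 1 on it. Distinct sets give distinct
  monomials, so coefficients never merge.\<close>

lemma low_degree_imp_rpoly:
  assumes "low_degree n d F"
  obtains P where "poly_vars P \<subseteq> {..<n}" "multilinear P" "total_degree P \<le> d" "eval_at P = F"
proof -
  obtain c where c: "\<And>x. F x = (\<Sum>S | S \<subseteq> {..<n} \<and> card S \<le> d. c S * of_bool (\<forall>i\<in>S. x i))"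
    using assms unfolding low_degree_def by blast
  define \<S> where "\<S> = {S. S \<subseteq> {..<n} \<and> card S \<le> d}"
  define mon :: "nat set \<Rightarrow> nat \<Rightarrow>\<^sub>0 nat" where "mon S = Abs_poly_mapping (\<lambda>i. of_bool (i \<in> S))" for S
  define P where "P = (\<Sum>S\<in>\<S>. Poly_Mapping.single (mon S) (c S))"
  have fin: "finite S" if "S \<in> \<S>" for S
    using that finite_subset by (auto simp: \<S>_def)
  have lm: "Poly_Mapping.lookup (mon S) = (\<lambda>i. of_bool (i \<in> S))" if "S \<in> \<S>" for S
    using fin[OF that] by (simp add: mon_def)
  have km: "Poly_Mapping.keys (mon S) = S" if "S \<in> \<S>" for S
    using lm[OF that] by (auto simp: in_keys_iff)
  have inj: "inj_on mon \<S>"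
    by (metis inj_onI km)
  have finS: "finite \<S>" by (simp add: \<S>_def)
  have lP: "Poly_Mapping.lookup P (mon S) = c S" if "S \<in> \<S>" for S
  proof -
    have "Poly_Mapping.lookup P (mon S) = (\<Sum>U\<in>\<S>. if U = S then c U else 0)"
      unfolding P_def lookup_sum using that inj
      by (intro sum.cong) (auto simp: lookup_single when_def inj_on_eq_iff)
    then show ?thesis using that finS by simp
  qed
  have kP: "Poly_Mapping.keys P \<subseteq> mon ` \<S>"
    unfolding P_def by (rule order_trans[OF keys_sum]) (auto split: if_splits)
  have "eval_at P x = F x" for x
  proof -
    have "eval_at P x = (\<Sum>m\<in>mon ` \<S>. Poly_Mapping.lookup P m * (\<Prod>i\<in>Poly_Mapping.keys m. of_bool (x i) ^ Poly_Mapping.lookup m i))"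
      unfolding poly_eval_def using kP finS
      by (intro sum.mono_neutral_left) (auto simp: in_keys_iff)
    also have "\<dots> = (\<Sum>S\<in>\<S>. c S * (\<Prod>i\<in>S. of_bool (x i)))"
      using inj by (subst sum.reindex) (auto simp: lP km lm intro!: sum.cong prod.cong)
    also have "\<dots> = F x"
      unfolding c \<S>_def[symmetric] using fin
      by (intro sum.cong refl arg_cong2[of _ _ _ _ "(*)"])
        (auto intro!: prod_zero)
    finally show ?thesis .
  qed
  moreover have "poly_vars P \<subseteq> {..<n}"
  proof -
    have "Poly_Mapping.keys (mon S) \<subseteq> {..<n}" if "S \<in> \<S>" for S
      using km[OF that] that by (simp add: \<S>_def)
    then show ?thesis using kP by (force simp: poly_vars_def)
  qed
  moreover have "multilinear P"
    using kP by (auto simp: multilinear_def lm dest!: subsetD)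
  moreover have "total_degree P \<le> d"
  proof -
    have "(\<Sum>i\<in>Poly_Mapping.keys m. Poly_Mapping.lookup m i) \<le> d" if "m \<in> Poly_Mapping.keys P" for m
    proof -
      obtain S where S: "S \<in> \<S>" "m = mon S" using kP \<open>m \<in> Poly_Mapping.keys P\<close> by blast
      then show ?thesis by (simp add: km lm) (simp add: \<S>_def)
    qed
    then show ?thesis unfolding total_degree_def by auto
  qed
  ultimately show ?thesis using that by blast
qed

section \<open>Averages over independent biased bits\<close>

lemma finite_cube [simp]: "finite (cube n)"
  by (simp add: cube_def finite_PiE)

lemma sum_cube_prod:
  fixes g :: "nat \<Rightarrow> bool \<Rightarrow> real"
  shows "(\<Sum>x\<in>cube n. \<Prod>i<n. g i (x i)) = (\<Prod>i<n. g i True + g i False)"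
  unfolding cube_def
  by (subst prod_sum_PiE[symmetric]) (simp_all add: UNIV_bool add.commute)

text \<open>The product distribution as a plain weight. Each coordinate has its own bias, so that
  some bits can be frozen at 0 by bias 0.\<close>

definition bernoulli_weight :: "nat \<Rightarrow> (nat \<Rightarrow> real) \<Rightarrow> (nat \<Rightarrow> bool) \<Rightarrow> real" where
  "bernoulli_weight n t x = (\<Prod>i<n. if x i then t i else 1 - t i)"

lemma sum_bernoulli_weight: "(\<Sum>x\<in>cube n. bernoulli_weight n t x) = 1"
  unfolding bernoulli_weight_def by (subst sum_cube_prod) simp

lemma bernoulli_weight_nonneg:
  "(\<And>i. i < n \<Longrightarrow> 0 \<le> t i \<and> t i \<le> 1) \<Longrightarrow> 0 \<le> bernoulli_weight n t x"
  unfolding bernoulli_weight_def by (intro prod_nonneg) auto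

lemma sum_bernoulli_weight_monomial:
  assumes "S \<subseteq> {..<n}"
  shows "(\<Sum>x\<in>cube n. bernoulli_weight n t x * of_bool (\<forall>i\<in>S. x i)) = (\<Prod>i\<in>S. t i)"
proof -
  have fin: "finite S" using assms finite_subset by blast
  have "of_bool (\<forall>i\<in>S. x i) = (\<Prod>i<n. if i \<in> S then of_bool (x i) else 1 :: real)" for x
  proof -
    have "(\<Prod>i<n. if i \<in> S then of_bool (x i) else 1) = (\<Prod>i\<in>S. of_bool (x i) :: real)"
      using assms by (intro prod.mono_neutral_cong_right) auto
    also have "\<dots> = of_bool (\<forall>i\<in>S. x i)"
      using fin by (auto intro!: prod_zero)
    finally show ?thesis by simp
  qed
  then have "(\<Sum>x\<in>cube n. bernoulli_weight n t x * of_bool (\<forall>i\<in>S. x i)) =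
      (\<Sum>x\<in>cube n. \<Prod>i<n. (if x i then t i else 1 - t i) * (if i \<in> S then of_bool (x i) else 1))"
    by (simp add: bernoulli_weight_def prod.distrib)
  also have "\<dots> = (\<Prod>i<n. if i \<in> S then t i else 1)"
    by (subst sum_cube_prod) (auto intro!: prod.cong)
  also have "\<dots> = (\<Prod>i\<in>S. t i)"
    using assms by (intro prod.mono_neutral_cong_right) auto
  finally show ?thesis .
qed

text \<open>The monomial of \<open>S\<close> averages to \<open>s ^ card S\<close> if
  \<open>S \<subseteq> A\<close> and to 0 or, in other words, to nothing otherwise, so the degree in
  \<open>s\<close> is at most \<open>d\<close>. The set \<open>A\<close> selects the random bits:
  one column for the rational degree, all bits for the certificate.\<close>

lemma low_degree_average:
  assumes "low_degree n d F"
  obtains p :: "real poly" where "Polynomial.degree p \<le> d"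
    "\<And>s. poly p s = (\<Sum>x\<in>cube n. bernoulli_weight n (\<lambda>i. if i \<in> A then s else 0) x * F x)"
proof -
  obtain c where c: "\<And>x. F x = (\<Sum>S | S \<subseteq> {..<n} \<and> card S \<le> d. c S * of_bool (\<forall>i\<in>S. x i))"
    using assms unfolding low_degree_def by blast
  define p where "p = (\<Sum>S | S \<subseteq> {..<n} \<and> card S \<le> d. monom (if S \<subseteq> A then c S else 0) (card S))"
  have "Polynomial.degree p \<le> d"
    unfolding p_def
    by (intro degree_sum_le) (auto intro: order_trans[OF degree_monom_le])
  moreover have "poly p s = (\<Sum>x\<in>cube n. bernoulli_weight n (\<lambda>i. if i \<in> A then s else 0) x * F x)" for s
  proof -
    have "(\<Sum>x\<in>cube n. bernoulli_weight n (\<lambda>i. if i \<in> A then s else 0) x * F x) =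
       (\<Sum>S | S \<subseteq> {..<n} \<and> card S \<le> d. c S *
         (\<Sum>x\<in>cube n. bernoulli_weight n (\<lambda>i. if i \<in> A then s else 0) x * of_bool (\<forall>i\<in>S. x i)))"
      unfolding c sum_distrib_left by (subst sum.swap) (simp only: mult.left_commute)
    also have "\<dots> = (\<Sum>S | S \<subseteq> {..<n} \<and> card S \<le> d. c S * (\<Prod>i\<in>S. if i \<in> A then s else 0))"
      by (intro sum.cong refl arg_cong2[of _ _ _ _ "(*)"] sum_bernoulli_weight_monomial) auto
    also have "\<dots> = poly p s"
      unfolding p_def poly_sum poly_monom
    proof (intro sum.cong refl)
      fix S assume "S \<in> {S. S \<subseteq> {..<n} \<and> card S \<le> d}"
      then have "finite S" using finite_subset by blast
      show "c S * (\<Prod>i\<in>S. if i \<in> A then s else 0) = (if S \<subseteq> A then c S else 0) * s ^ card S"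
      proof (cases "S \<subseteq> A")
        case True
        then have "(\<Prod>i\<in>S. if i \<in> A then s else 0) = (\<Prod>i\<in>S. s)"
          by (intro prod.cong) auto
        with True show ?thesis by simp
      next
        case False
        then have "(\<Prod>i\<in>S. if i \<in> A then s else 0) = 0"
          using \<open>finite S\<close> by (intro prod_zero) auto
        with False show ?thesis by simp
      qed
    qed
    finally show ?thesis by simp
  qed
  ultimately show ?thesis using that by blast
qed

section \<open>The matrix function\<close>

text \<open>Detects a row of weight one as a zero of a polynomial of degree 1.\<close>

lemma ex1_iff_sum_of_bool_eq_1:
  fixes m :: nat
  shows "(\<exists>!c. c < m \<and> z c) \<longleftrightarrow> (\<Sum>c<m. of_bool (z c)) = (1::real)"
proof -
  have sum: "(\<Sum>c<m. of_bool (z c)) = real (card {c. c < m \<and> z c})"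
  proof -
    have "{..<m} \<inter> {c. z c} = {c. c < m \<and> z c}" by blast
    then show ?thesis by (simp add: of_bool_def sum.If_cases)
  qed
  show ?thesis
  proof
    assume "\<exists>!c. c < m \<and> z c"
    then obtain a where a: "a < m \<and> z a" "\<forall>k. k < m \<and> z k \<longrightarrow> k = a" by (rule ex1E)
    then have "{c. c < m \<and> z c} = {a}" by blast
    then show "(\<Sum>c<m. of_bool (z c)) = (1::real)" unfolding sum by simp
  next
    assume "(\<Sum>c<m. of_bool (z c)) = (1::real)"
    then have "card {c. c < m \<and> z c} = 1" unfolding sum by linarith
    then obtain a where a: "{c. c < m \<and> z c} = {a}" by (rule card_1_singletonE)
    show "\<exists>!c. c < m \<and> z c"
    proof (rule ex1I)
      show "a < m \<and> z a" using a by blast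
      show "k = a" if "k < m \<and> z k" for k using a that by blast
    qed
  qed
qed

text \<open>The summand for \<open>c\<close> indicates that \<open>c\<close> is the only position of
  a \<open>1\<close>; these cases are mutually exclusive. Unlike the degree 1 test, this is an exact
  indicator, at the price of degree \<open>m\<close>.\<close>

lemma of_bool_ex1_eq_sum:
  fixes m :: nat
  shows "of_bool (\<exists>!c. c < m \<and> z c) =
     (\<Sum>c<m. of_bool (z c) * (\<Prod>k\<in>{..<m} - {c}. 1 - of_bool (z k)) :: real)"
proof -
  have *: "of_bool (z c) * (\<Prod>k\<in>{..<m} - {c}. 1 - of_bool (z k)) =
      (of_bool (z c \<and> (\<forall>k<m. z k \<longrightarrow> k = c)) :: real)" for c
  proof (cases "\<forall>k<m. z k \<longrightarrow> k = c")
    case True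
    then have "(\<Prod>k\<in>{..<m} - {c}. 1 - of_bool (z k)) = (1::real)" by (intro prod.neutral) auto
    with True show ?thesis by simp
  next
    case False
    then obtain k where "k < m" "z k" "k \<noteq> c" by blast
    then have "(\<Prod>k\<in>{..<m} - {c}. 1 - of_bool (z k)) = (0::real)"
      by (intro prod_zero bexI[of _ k]) auto
    then show ?thesis using False by (simp only: mult_zero_right simp_thms of_bool_eq)
  qed
  show ?thesis
  proof (cases "\<exists>!c. c < m \<and> z c")
    case True
    then obtain a where a: "a < m" "z a" "\<And>k. k < m \<Longrightarrow> z k \<Longrightarrow> k = a" by blast
    have "z c \<and> (\<forall>k<m. z k \<longrightarrow> k = c) \<longleftrightarrow> c = a" if "c < m" for c
      using a that by blast
    then have "(\<Sum>c<m. of_bool (z c \<and> (\<forall>k<m. z k \<longrightarrow> k = c))) = (\<Sum>c<m. if c = a then 1 else 0 :: real)"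
      by (intro sum.cong) simp_all
    also have "\<dots> = 1" using \<open>a < m\<close> by simp
    finally show ?thesis unfolding * using True by (simp only: of_bool_eq)
  next
    case False
    have "\<not> (z c \<and> (\<forall>k<m. z k \<longrightarrow> k = c))" if "c < m" for c
      using False that by blast
    then have "(\<Sum>c<m. of_bool (z c \<and> (\<forall>k<m. z k \<longrightarrow> k = c))) = (0::real)"
      by (intro sum.neutral) simp
    then show ?thesis unfolding * using False by (simp only: of_bool_eq)
  qed
qed

text \<open>Each of the \<open>m\<close> exclusive positions of a unique \<open>1\<close> has weight
  \<open>s * (1 - s) ^ (m - 1)\<close>; the claim is about the complement.\<close>

lemma sum_bernoulli_weight_not_ex1:
  "(\<Sum>z\<in>cube m. bernoulli_weight m (\<lambda>_. s) z * of_bool (\<not> (\<exists>!c. c < m \<and> z c))) =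
     1 - real m * s * (1 - s) ^ (m - 1)"
proof -
  have "(\<Sum>z\<in>cube m. bernoulli_weight m (\<lambda>_. s) z * (of_bool (z c) * (\<Prod>k\<in>{..<m} - {c}. 1 - of_bool (z k))))
      = s * (1 - s) ^ (m - 1)" if c: "c < m" for c
  proof -
    have "of_bool (z c) * (\<Prod>k\<in>{..<m} - {c}. 1 - of_bool (z k)) =
        (\<Prod>k<m. if k = c then of_bool (z k) else 1 - of_bool (z k) :: real)" for z
      using c by (subst (2) prod.remove[of _ c]) (auto intro!: prod.cong)
    then have "(\<Sum>z\<in>cube m. bernoulli_weight m (\<lambda>_. s) z * (of_bool (z c) * (\<Prod>k\<in>{..<m} - {c}. 1 - of_bool (z k))))
       = (\<Sum>z\<in>cube m. \<Prod>k<m. (if z k then s else 1 - s) * (if k = c then of_bool (z k) else 1 - of_bool (z k)))"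
      by (simp add: bernoulli_weight_def prod.distrib)
    also have "\<dots> = (\<Prod>k<m. if k = c then s else 1 - s)"
      by (subst sum_cube_prod) (auto intro!: prod.cong)
    also have "\<dots> = s * (\<Prod>k\<in>{..<m} - {c}. 1 - s)"
      using c by (subst prod.remove[of _ c]) (auto intro!: prod.cong)
    also have "\<dots> = s * (1 - s) ^ (m - 1)"
      using c by simp
    finally show ?thesis .
  qed
  then have "(\<Sum>c<m. \<Sum>z\<in>cube m. bernoulli_weight m (\<lambda>_. s) z *
      (of_bool (z c) * (\<Prod>k\<in>{..<m} - {c}. 1 - of_bool (z k)))) = real m * (s * (1 - s) ^ (m - 1))"
    by simp
  then have "(\<Sum>z\<in>cube m. bernoulli_weight m (\<lambda>_. s) z * of_bool (\<exists>!c. c < m \<and> z c)) = real m * s * (1 - s) ^ (m - 1)"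
    unfolding of_bool_ex1_eq_sum sum_distrib_left by (subst sum.swap) simp
  moreover have "of_bool (\<not> Q) = 1 - (of_bool Q :: real)" for Q by simp
  ultimately show ?thesis
    by (simp only: right_diff_distrib sum_subtractf mult_1_right sum_bernoulli_weight)
qed

lemma grid_index_less: "r < m \<Longrightarrow> c < m \<Longrightarrow> r * m + c < m\<^sup>2" for m :: nat
proof -
  assume "r < m" "c < m"
  then have "r * m + c < Suc r * m" by simp
  also have "\<dots> \<le> m * m" using \<open>r < m\<close> by (intro mult_le_mono1) simp
  finally show ?thesis by (simp add: power2_eq_square)
qed

text \<open>Independence of the rows: \<open>i div m\<close> and \<open>i mod m\<close> identify an
  input with an \<open>m\<close>-tuple of rows, and the sum of products factorises. The restrictions
  make each row a member of \<open>cube m\<close>.\<close>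

lemma sum_cube_square_prod_rows:
  fixes H :: "(nat \<Rightarrow> bool) \<Rightarrow> real"
  shows "(\<Sum>x\<in>cube (m\<^sup>2). \<Prod>r<m. H (\<lambda>c\<in>{..<m}. x (r * m + c))) = (\<Sum>z\<in>cube m. H z) ^ m"
proof -
  have "(\<Sum>z\<in>cube m. H z) ^ m = (\<Sum>g\<in>PiE {..<m} (\<lambda>_. cube m). \<Prod>r<m. H (g r))"
    by (subst prod_sum_PiE[symmetric]) simp_all
  also have "\<dots> = (\<Sum>x\<in>cube (m\<^sup>2). \<Prod>r<m. H (\<lambda>c\<in>{..<m}. x (r * m + c)))"
  proof (rule sum.reindex_bij_witness[where i = "\<lambda>x. \<lambda>r\<in>{..<m}. \<lambda>c\<in>{..<m}. x (r * m + c)" and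
        j = "\<lambda>g. \<lambda>i\<in>{..<m\<^sup>2}. g (i div m) (i mod m)"])
    fix x assume x: "x \<in> cube (m\<^sup>2)"
    show "(\<lambda>r\<in>{..<m}. \<lambda>c\<in>{..<m}. x (r * m + c)) \<in> PiE {..<m} (\<lambda>_. cube m)"
      by (auto simp: cube_def)
    show "(\<lambda>i\<in>{..<m\<^sup>2}. (\<lambda>r\<in>{..<m}. \<lambda>c\<in>{..<m}. x (r * m + c)) (i div m) (i mod m)) = x"
    proof (rule extensionalityI[of _ "{..<m\<^sup>2}"])
      fix i assume "i \<in> {..<m\<^sup>2}"
      then have "m > 0" by (auto intro: gr0I)
      then have "i div m < m" "i mod m < m"
        using \<open>i \<in> {..<m\<^sup>2}\<close> by (auto simp: power2_eq_square less_mult_imp_div_less)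
      then show "(\<lambda>i\<in>{..<m\<^sup>2}. (\<lambda>r\<in>{..<m}. \<lambda>c\<in>{..<m}. x (r * m + c)) (i div m) (i mod m)) i = x i"
        using \<open>i \<in> {..<m\<^sup>2}\<close> by simp
    qed (use x in \<open>auto simp: cube_def PiE_def\<close>)
  next
    fix g assume g: "g \<in> PiE {..<m} (\<lambda>_. cube m)"
    show "(\<lambda>i\<in>{..<m\<^sup>2}. g (i div m) (i mod m)) \<in> cube (m\<^sup>2)"
      by (auto simp: cube_def)
    have *: "(\<lambda>c\<in>{..<m}. (\<lambda>i\<in>{..<m\<^sup>2}. g (i div m) (i mod m)) (r * m + c)) = g r" if "r < m" for r
    proof (rule extensionalityI[of _ "{..<m}"])
      show "g r \<in> extensional {..<m}" using g that by (auto simp: cube_def PiE_def Pi_def)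
    qed (use that grid_index_less[OF that] in auto)
    show "(\<lambda>r\<in>{..<m}. \<lambda>c\<in>{..<m}. (\<lambda>i\<in>{..<m\<^sup>2}. g (i div m) (i mod m)) (r * m + c)) = g"
    proof (rule extensionalityI[of _ "{..<m}"])
      show "g \<in> extensional {..<m}" using g by (auto simp: PiE_def)
    qed (simp_all only: * restrict_extensional restrict_apply' lessThan_iff)
    show "(\<Prod>r<m. H (\<lambda>c\<in>{..<m}. (\<lambda>i\<in>{..<m\<^sup>2}. g (i div m) (i mod m)) (r * m + c))) = (\<Prod>r<m. H (g r))"
      by (intro prod.cong) (simp_all only: * lessThan_iff)
  qed
  finally show ?thesis by simp
qed

section \<open>The matrix function and its average\<close>

definition no_single_row :: "nat \<Rightarrow> (nat \<Rightarrow> bool) \<Rightarrow> bool" where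
  "no_single_row m x \<longleftrightarrow> (\<forall>r<m. \<not> (\<exists>!c. c < m \<and> x (r * m + c)))"

definition grid_fun :: "nat \<Rightarrow> (nat \<Rightarrow> bool) \<rightharpoonup> bool" where
  "grid_fun m = (\<lambda>x. if x \<in> cube (m\<^sup>2) then Some (no_single_row m x) else None)"

lemma dom_grid_fun [simp]: "dom (grid_fun m) = cube (m\<^sup>2)"
  by (auto simp: grid_fun_def split: if_splits)

text \<open>The restriction leaves the value \<open>undefined\<close> beyond \<open>n\<close>, as
  membership in \<open>cube n\<close> requires.\<close>

definition zero_input :: "nat \<Rightarrow> nat \<Rightarrow> bool" where
  "zero_input n = (\<lambda>i\<in>{..<n}. False)"

lemma zero_input_in_cube [simp]: "zero_input n \<in> cube n"
  by (auto simp: zero_input_def cube_def)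

lemma eq_zero_input: "x \<in> cube n \<Longrightarrow> (\<And>i. i < n \<Longrightarrow> \<not> x i) \<Longrightarrow> x = zero_input n"
  by (rule extensionalityI[of _ "{..<n}"]) (auto simp: zero_input_def cube_def PiE_def)

lemma no_single_row_zero_input: "no_single_row m (zero_input (m\<^sup>2))"
  using grid_index_less by (auto simp: no_single_row_def zero_input_def)

lemma sum_bernoulli_weight_no_single_row:
  "(\<Sum>x\<in>cube (m\<^sup>2). bernoulli_weight (m\<^sup>2) (\<lambda>_. s) x * of_bool (no_single_row m x)) =
     (1 - real m * s * (1 - s) ^ (m - 1)) ^ m"
proof -
  have "bernoulli_weight (m\<^sup>2) (\<lambda>_. s) x * of_bool (no_single_row m x) =
     (\<Prod>r<m. bernoulli_weight m (\<lambda>_. s) (\<lambda>c\<in>{..<m}. x (r * m + c)) *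
       of_bool (\<not> (\<exists>!c. c < m \<and> (\<lambda>c\<in>{..<m}. x (r * m + c)) c)))" for x
  proof -
    have "bernoulli_weight (m\<^sup>2) (\<lambda>_. s) x = (\<Prod>r<m. \<Prod>c<m. if x (r * m + c) then s else 1 - s)"
    proof -
      have "(\<Prod>i\<in>{r * m..<r * m + m}. if x i then s else 1 - s) = (\<Prod>c<m. if x (r * m + c) then s else 1 - s)" for r
        by (simp add: prod.atLeastLessThan_shift_0 atLeast0LessThan comp_def)
      then show ?thesis
        unfolding bernoulli_weight_def power2_eq_square prod.nat_group[symmetric] by simp
    qed
    also have "\<dots> = (\<Prod>r<m. bernoulli_weight m (\<lambda>_. s) (\<lambda>c\<in>{..<m}. x (r * m + c)))"
      unfolding bernoulli_weight_def by (intro prod.cong) auto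
    finally have 1: "bernoulli_weight (m\<^sup>2) (\<lambda>_. s) x =
      (\<Prod>r<m. bernoulli_weight m (\<lambda>_. s) (\<lambda>c\<in>{..<m}. x (r * m + c)))" .
    have "of_bool (no_single_row m x) = (\<Prod>r<m. of_bool (\<not> (\<exists>!c. c < m \<and> x (r * m + c))) :: real)"
      by (auto simp: no_single_row_def intro!: prod.neutral)
    also have "\<dots> = (\<Prod>r<m. of_bool (\<not> (\<exists>!c. c < m \<and> (\<lambda>c\<in>{..<m}. x (r * m + c)) c)))"
      by (intro prod.cong refl arg_cong[of _ _ of_bool]) (auto simp: cong: conj_cong)
    finally show ?thesis unfolding 1 by (simp only: prod.distrib)
  qed
  then show ?thesis
    using sum_cube_square_prod_rows[where m = m and H = "\<lambda>z. bernoulli_weight m (\<lambda>_. s) z * of_bool (\<not> (\<exists>!c. c < m \<and> z c))"]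
    by (simp only: sum_bernoulli_weight_not_ex1)
qed

section \<open>The rational degree of the matrix function\<close>

lemma low_degree_no_single_row:
  obtains F where "low_degree (m\<^sup>2) m F" "\<And>x. F x \<noteq> 0 \<longleftrightarrow> no_single_row m x"
proof -
  define F where "F = (\<lambda>x. \<Prod>r<m. (\<Sum>c<m. of_bool (x (r * m + c))) - (1::real))"
  have "low_degree (m\<^sup>2) (card {..<m} * 1) F"
    unfolding F_def
    by (intro low_degree_prod low_degree_diff low_degree_sum low_degree_var low_degree_const)
      (auto intro: grid_index_less)
  moreover have "F x \<noteq> 0 \<longleftrightarrow> no_single_row m x" for x
    unfolding F_def no_single_row_def ex1_iff_sum_of_bool_eq_1
    by (simp only: prod_zero_iff finite_lessThan right_minus_eq lessThan_iff Ball_def Bex_def) blast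
  ultimately show ?thesis using that by simp
qed

text \<open>Exact indicators are nonnegative, so summing them over the rows cannot cancel.\<close>

lemma low_degree_single_row:
  obtains F where "low_degree (m\<^sup>2) m F" "\<And>x. F x \<noteq> 0 \<longleftrightarrow> \<not> no_single_row m x"
proof -
  define F where "F = (\<lambda>x. \<Sum>r<m. of_bool (\<exists>!c. c < m \<and> x (r * m + c)) :: real)"
  have "low_degree (m\<^sup>2) m (\<lambda>x. of_bool (x (r * m + c)) * (\<Prod>k\<in>{..<m} - {c}. 1 - of_bool (x (r * m + k))))"
    if "r < m" "c < m" for r c
  proof -
    have "low_degree (m\<^sup>2) (1 + card ({..<m} - {c}) * 1)
        (\<lambda>x. of_bool (x (r * m + c)) * (\<Prod>k\<in>{..<m} - {c}. 1 - of_bool (x (r * m + k))))"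
      using that
      by (intro low_degree_mult low_degree_prod low_degree_diff low_degree_var low_degree_const)
        (auto intro: grid_index_less)
    then show ?thesis using that by simp
  qed
  then have "low_degree (m\<^sup>2) m F"
    unfolding F_def of_bool_ex1_eq_sum by (intro low_degree_sum) auto
  moreover have "F x \<noteq> 0 \<longleftrightarrow> \<not> no_single_row m x" for x
    unfolding F_def no_single_row_def by (subst sum_nonneg_eq_0_iff) auto
  ultimately show ?thesis using that by blast
qed

text \<open>At each input exactly one of \<open>F\<close> and \<open>G\<close> is nonzero, so
  \<open>F + G\<close> never vanishes and \<open>F / (F + G)\<close> is 1 or 0 as required.\<close>

lemma rdeg_grid_fun_witness:
  obtains P Q where "poly_vars P \<subseteq> {..<m\<^sup>2}" "poly_vars Q \<subseteq> {..<m\<^sup>2}"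
    "total_degree P \<le> m" "total_degree Q \<le> m"
    "\<And>x. x \<in> cube (m\<^sup>2) \<Longrightarrow> eval_at Q x \<noteq> 0 \<and> eval_at P x / eval_at Q x = of_bool (the (grid_fun m x))"
proof -
  obtain F where F: "low_degree (m\<^sup>2) m F" "\<And>x. F x \<noteq> 0 \<longleftrightarrow> no_single_row m x"
    using low_degree_no_single_row by blast
  obtain G where G: "low_degree (m\<^sup>2) m G" "\<And>x. G x \<noteq> 0 \<longleftrightarrow> \<not> no_single_row m x"
    using low_degree_single_row by blast
  obtain P where P: "poly_vars P \<subseteq> {..<m\<^sup>2}" "total_degree P \<le> m" "eval_at P = F"
    using low_degree_imp_rpoly[OF F(1)] by metis
  obtain Q where Q: "poly_vars Q \<subseteq> {..<m\<^sup>2}" "total_degree Q \<le> m" "eval_at Q = (\<lambda>x. F x + G x)"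
    using low_degree_imp_rpoly[OF low_degree_add[OF F(1) G(1)]] by metis
  have "eval_at Q x \<noteq> 0 \<and> eval_at P x / eval_at Q x = of_bool (the (grid_fun m x))"
    if "x \<in> cube (m\<^sup>2)" for x
    using fun_cong[OF P(3), of x] fun_cong[OF Q(3), of x] F(2)[of x] G(2)[of x] that
    by (cases "no_single_row m x") (auto simp: grid_fun_def)
  with P Q that show ?thesis by blast
qed

text \<open>
  Randomising only the first column with bias \<open>s\<close>, every row has at most one entry, so only the
  zero input contributes and the average is a nonzero multiple of \<open>(1 - s) ^ m\<close>.
\<close>
lemma low_degree_no_single_row_ge:
  assumes F: "low_degree (m\<^sup>2) d F"
    and nz: "\<And>x. x \<in> cube (m\<^sup>2) \<Longrightarrow> F x \<noteq> 0 \<longleftrightarrow> no_single_row m x"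
  shows "m \<le> d"
proof -
  define A where "A = (\<lambda>r. r * m) ` {..<m}"
  obtain p :: "real poly" where p: "Polynomial.degree p \<le> d"
    "\<And>s. poly p s = (\<Sum>x\<in>cube (m\<^sup>2). bernoulli_weight (m\<^sup>2) (\<lambda>i. if i \<in> A then s else 0) x * F x)"
    using low_degree_average[OF F] by metis
  have F0: "F (zero_input (m\<^sup>2)) \<noteq> 0"
    using nz[OF zero_input_in_cube] no_single_row_zero_input by simp
  have "A \<subseteq> {..<m\<^sup>2}"
    using grid_index_less[of _ m 0] by (auto simp: A_def)
  have "card A = m"
    unfolding A_def by (subst card_image) (auto intro!: inj_onI)
  have other: "bernoulli_weight (m\<^sup>2) (\<lambda>i. if i \<in> A then s else 0) x * F x = 0"
    if x: "x \<in> cube (m\<^sup>2)" "x \<noteq> zero_input (m\<^sup>2)" for x s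
  proof (rule ccontr)
    assume *: "\<not> ?thesis"
    then have nsr: "no_single_row m x" using nz x by auto
    have sub: "i \<in> A" if "i < m\<^sup>2" "x i" for i
    proof (rule ccontr)
      assume "i \<notin> A"
      then have "bernoulli_weight (m\<^sup>2) (\<lambda>i. if i \<in> A then s else 0) x = 0"
        unfolding bernoulli_weight_def using that by (intro prod_zero) auto
      with * show False by simp
    qed
    obtain i where i: "i < m\<^sup>2" "x i" using x eq_zero_input by blast
    then obtain r where r: "r < m" "i = r * m" using sub by (auto simp: A_def)
    have "c = 0" if "c < m" "x (r * m + c)" for c
    proof -
      obtain r' where "r * m + c = r' * m"
        using sub[OF grid_index_less[OF r(1) \<open>c < m\<close>] \<open>x (r * m + c)\<close>] by (auto simp: A_def)
      then have "(r * m + c) mod m = 0" by simp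
      then show ?thesis using that by simp
    qed
    then have "\<exists>!c. c < m \<and> x (r * m + c)"
      using r i by (intro ex1I[of _ 0]) auto
    then show False using nsr r by (auto simp: no_single_row_def)
  qed
  have "poly p s = poly (smult (F (zero_input (m\<^sup>2))) ([:1, -1:] ^ m)) s" for s
  proof -
    have "poly p s = bernoulli_weight (m\<^sup>2) (\<lambda>i. if i \<in> A then s else 0) (zero_input (m\<^sup>2)) * F (zero_input (m\<^sup>2))"
      unfolding p(2) by (subst sum.remove[of _ "zero_input (m\<^sup>2)"]) (auto intro!: sum.neutral simp: other)
    also have "bernoulli_weight (m\<^sup>2) (\<lambda>i. if i \<in> A then s else 0) (zero_input (m\<^sup>2)) = (\<Prod>i\<in>A. 1 - s)"
      unfolding bernoulli_weight_def using \<open>A \<subseteq> _\<close>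
      by (intro prod.mono_neutral_cong_right) (auto simp: zero_input_def)
    finally show ?thesis by (simp add: \<open>card A = m\<close>)
  qed
  then have "p = smult (F (zero_input (m\<^sup>2))) ([:1, -1:] ^ m)"
    by (simp add: poly_eq_poly_eq_iff[symmetric] fun_eq_iff)
  then have "Polynomial.degree p = m"
    using F0 by (simp add: degree_power_eq)
  with p show ?thesis by simp
qed

text \<open>For the lower bound, the denominator is nonzero on the whole cube, so the numerator
  alone vanishes exactly where the function is false, and \<open>low_degree_no_single_row_ge\<close>
  applies to it.\<close>

lemma rdeg_grid_fun: "rdeg (m\<^sup>2) (grid_fun m) = m"
proof -
  let ?R = "\<lambda>d. \<exists>P Q. poly_vars P \<subseteq> {..<m\<^sup>2} \<and> poly_vars Q \<subseteq> {..<m\<^sup>2} \<and>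
     max (total_degree P) (total_degree Q) = d \<and>
     (\<forall>x\<in>dom (grid_fun m). eval_at Q x \<noteq> 0 \<and> eval_at P x / eval_at Q x = of_bool (the (grid_fun m x)))"
  have ge: "m \<le> d" if R: "?R d" for d
  proof -
    obtain P Q where PQ: "poly_vars P \<subseteq> {..<m\<^sup>2}" "max (total_degree P) (total_degree Q) = d"
      "\<forall>x\<in>dom (grid_fun m). eval_at Q x \<noteq> 0 \<and> eval_at P x / eval_at Q x = of_bool (the (grid_fun m x))"
      using R by blast
    show ?thesis
    proof (rule low_degree_no_single_row_ge)
      show "low_degree (m\<^sup>2) d (eval_at P)"
        using PQ by (intro low_degree_eval_at) auto
      fix x assume x: "x \<in> cube (m\<^sup>2)"
      then have "eval_at Q x \<noteq> 0" "eval_at P x / eval_at Q x = of_bool (no_single_row m x)"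
        using PQ(3) by (simp_all only: dom_grid_fun) (simp_all add: grid_fun_def)
      then show "eval_at P x \<noteq> 0 \<longleftrightarrow> no_single_row m x"
        by (cases "no_single_row m x") auto
    qed
  qed
  obtain P Q where PQ: "poly_vars P \<subseteq> {..<m\<^sup>2}" "poly_vars Q \<subseteq> {..<m\<^sup>2}"
    "total_degree P \<le> m" "total_degree Q \<le> m"
    "\<And>x. x \<in> cube (m\<^sup>2) \<Longrightarrow> eval_at Q x \<noteq> 0 \<and> eval_at P x / eval_at Q x = of_bool (the (grid_fun m x))"
    using rdeg_grid_fun_witness by metis
  then have "?R (max (total_degree P) (total_degree Q))"
    unfolding dom_grid_fun by blast
  \<comment> \<open>\<open>rdeg\<close> asks for the degree exactly; the lower bound pins the
    witness, of degree at most \<open>m\<close>, to \<open>m\<close>.\<close>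
  moreover from ge[OF this] have "max (total_degree P) (total_degree Q) = m"
    using PQ by linarith
  ultimately have "?R m" by (simp only:)
  then have "(LEAST d. ?R d) = m"
    by (rule Least_equality[of ?R]) (rule ge)
  then show ?thesis
    unfolding rdeg_def .
qed

section \<open>The certificate degree\<close>

text \<open>
  The step \<open>h = 1 / (2 * N * sqrt m)\<close> places the nodes \<open>s = sin\<^sup>2 (j * h / 2)\<close>, \<open>N < j \<le> 2 * N\<close>, between
  \<open>1 / (64 * m)\<close> and \<open>1 / (4 * m)\<close>; taking \<open>N = m div 400\<close> makes \<open>9 ^ N\<close> negligible against the
  decay \<open>exp (- m / 100)\<close> of \<open>p\<close> there.
\<close>
lemma eventually_degree_ge:
  "eventually (\<lambda>m. \<forall>p D. Polynomial.degree p \<le> D \<longrightarrow> poly p 0 = 1 \<longrightarrow>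
     (\<forall>s\<in>{0..1}. 0 \<le> poly p s \<and> poly p s \<le> 1 \<and> poly p s \<le> (1 - real m * s * (1 - s) ^ (m - 1)) ^ m) \<longrightarrow>
     real m powr (3/2) / 3200 \<le> real D) sequentially"
proof -
  \<comment> \<open>The first two facts keep each error term of \<open>poly_at_0_le\<close> below
    \<open>1/2\<close>, contradicting \<open>poly p 0 = 1\<close>; the third gives
    \<open>N \<ge> 2\<close>.\<close>
  have "eventually (\<lambda>m::nat. ((real m)\<^sup>2 + 1) * 2 powr (1 - real m / 400) < 1/2) sequentially"
    by real_asymp
  moreover have "eventually (\<lambda>m::nat. exp (- (real m / 400)) < 1/2) sequentially"
    by real_asymp
  moreover have "eventually (\<lambda>m. m \<ge> (800::nat)) sequentially"
    by (rule eventually_ge_at_top)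
  ultimately show ?thesis
  proof eventually_elim
    case (elim m)
    show ?case
    proof (intro allI impI)
      fix p :: "real poly" and D :: nat
      assume deg: "Polynomial.degree p \<le> D" and p0: "poly p 0 = 1"
        and p: "\<forall>s\<in>{0..1}. 0 \<le> poly p s \<and> poly p s \<le> 1 \<and> poly p s \<le> (1 - real m * s * (1 - s) ^ (m - 1)) ^ m"
      define N where "N = m div 400"
      have N: "real N \<ge> real m / 400 - 1" "real N \<le> real m / 400" "N \<ge> 2"
        unfolding N_def using elim(3) by linarith+
      define h where "h = 1 / (2 * real N * sqrt (real m))"
      have m: "real m \<ge> 800" using elim(3) by simp
      then have sm: "sqrt (real m) > 1" by simp
      have h0: "h > 0" using N sm by (simp add: h_def)
      \<comment> \<open>This threshold yields \<open>D * h \<le> 1/8\<close>, hence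
        \<open>4 * D * h \<le> 1/2\<close>. Since \<open>N \<ge> m / 800\<close>, it is at least
        \<open>m powr (3/2) / 3200\<close>.\<close>
      have "\<not> real D < real N * sqrt (real m) / 4"
      proof
        assume D: "real D < real N * sqrt (real m) / 4"
        then have "real D * h \<le> real N * sqrt (real m) / 4 * h"
          using h0 by (intro mult_right_mono) auto
        also have "\<dots> = 1/8" using N sm by (simp add: h_def)
        finally have Dh: "real D * h \<le> 1/8" .
        have small: "\<bar>poly p ((sin (real j * h / 2))\<^sup>2)\<bar> \<le> exp (- (real m / 100))"
          if j: "N < j" "j \<le> 2 * N" for j
        proof -
          define x where "x = real j * h / 2"
          define s where "s = (sin x)\<^sup>2"
          have "x \<ge> real N * h / 2" "x \<le> real (2 * N) * h / 2"
            unfolding x_def using j h0 by (intro divide_right_mono mult_right_mono; simp)+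
          then have x: "x \<ge> 1 / (4 * sqrt (real m))" "x \<le> 1 / (2 * sqrt (real m))"
            using N sm by (simp_all add: h_def)
          have "1 \<le> 2 * sqrt (real m)" using sm by linarith
          then have "1 / (2 * sqrt (real m)) \<le> 1" "0 \<le> 1 / (4 * sqrt (real m))"
            by (simp_all only: divide_le_eq_1 zero_le_divide_iff) auto
          then have x01: "0 \<le> x" "x \<le> 1" using x by linarith+
          have "(1 / (8 * sqrt (real m)))\<^sup>2 \<le> s"
            unfolding s_def using half_le_sin[OF x01] x sm by (intro power_mono) auto
          then have s1: "1 / (64 * real m) \<le> s" by (simp add: power_divide power_mult_distrib)
          have "s \<le> (1 / (2 * sqrt (real m)))\<^sup>2"
            unfolding s_def using half_le_sin[OF x01] sin_x_le_x[OF x01(1)] x x01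
            by (intro power_mono) linarith+
          then have s2: "s \<le> 1 / (4 * real m)" by (simp add: power_divide power_mult_distrib)
          have ms: "1/64 \<le> real m * s" "real m * s \<le> 1/4"
            using s1 s2 m by (simp_all add: field_simps)
          have s01: "0 \<le> s" "s \<le> 1"
            by (simp_all add: s_def abs_square_le_1)
          have "1 + real (m - 1) * (- s) \<le> (1 + (- s)) ^ (m - 1)"
            using s01 by (intro Bernoulli_inequality) simp
          moreover have "real (m - 1) * s \<le> real m * s"
            using s01 by (intro mult_right_mono) auto
          ultimately have "3/4 \<le> (1 - s) ^ (m - 1)" using ms by simp
          then have "1/64 * (3/4) \<le> real m * s * (1 - s) ^ (m - 1)"
            using ms by (intro mult_mono) auto
          moreover have "real m * s * (1 - s) ^ (m - 1) \<le> 1/4 * 1"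
            using ms s01 by (intro mult_mono power_le_one) auto
          \<comment> \<open>The lower bound \<open>3/256\<close> exceeds \<open>1/100\<close>, and
            the upper bound \<open>1/4\<close> keeps the base nonnegative, so that powers are
            monotone.\<close>
          ultimately have "(1 - real m * s * (1 - s) ^ (m - 1)) ^ m \<le> (1 + - 1/100) ^ m"
            by (intro power_mono) linarith+
          also have "\<dots> \<le> exp (- 1/100) ^ m"
            using exp_ge_add_one_self[of "- 1/100"] by (intro power_mono) auto
          also have "\<dots> = exp (- (real m / 100))"
            by (simp add: exp_of_nat_mult[symmetric])
          finally have "(1 - real m * s * (1 - s) ^ (m - 1)) ^ m \<le> exp (- (real m / 100))" .
          moreover have "0 \<le> poly p s" "poly p s \<le> (1 - real m * s * (1 - s) ^ (m - 1)) ^ m"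
            using bspec[OF p, of s] s01 by simp_all
          ultimately have "\<bar>poly p s\<bar> \<le> exp (- (real m / 100))" by linarith
          then show ?thesis unfolding s_def x_def .
        qed
        have "\<bar>poly p 0\<bar> \<le> real (2 * D + 1) * (4 * real D * h) ^ N + 9 ^ N * exp (- (real m / 100))"
          using deg p h0 Dh small by (intro poly_at_0_le) auto
        moreover have "real (2 * D + 1) * (4 * real D * h) ^ N < 1/2"
        proof -
          have "sqrt (real m) \<le> real m"
            using m by (intro real_le_lsqrt) (auto simp: power2_eq_square)
          then have "real N * sqrt (real m) \<le> real m * real m"
            using N m by (intro mult_mono) auto
          then have 1: "real (2 * D + 1) \<le> (real m)\<^sup>2 + 1"
            using D by (simp add: power2_eq_square)
          have "(4 * real D * h) ^ N \<le> (1/2) ^ N"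
            using Dh h0 by (intro power_mono) auto
          also have "\<dots> = 2 powr (- real N)"
            by (simp add: powr_minus powr_realpow power_one_over inverse_eq_divide)
          also have "\<dots> \<le> 2 powr (1 - real m / 400)"
            using N by (intro powr_mono) auto
          finally have "real (2 * D + 1) * (4 * real D * h) ^ N \<le> ((real m)\<^sup>2 + 1) * 2 powr (1 - real m / 400)"
            using 1 h0 by (intro mult_mono) auto
          with elim(1) show ?thesis by linarith
        qed
        moreover have "9 ^ N * exp (- (real m / 100)) < 1/2"
        proof -
          \<comment> \<open>The aim is \<open>9 \<le> exp 3\<close>: then \<open>9 ^ N\<close> is at
            most \<open>exp (3 * m / 400)\<close>, which leaves \<open>exp (- m / 400)\<close> of
            the decay.\<close>
          have "(5/2::real) \<le> exp 1"
            using exp_lower_Taylor_quadratic[of 1] by simp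
          then have "(5/2::real) ^ 3 \<le> exp 1 ^ 3" by (intro power_mono) auto
          moreover have "exp 1 ^ 3 = exp (3::real)"
            using exp_of_nat_mult[of 3 "1::real"] by simp
          ultimately have "(9::real) \<le> exp 3" by (simp add: power3_eq_cube)
          then have "(9::real) ^ N \<le> exp 3 ^ N" by (intro power_mono) auto
          also have "\<dots> = exp (3 * real N)"
            by (subst exp_of_nat_mult[symmetric]) (simp only: mult.commute)
          also have "\<dots> \<le> exp (3 * (real m / 400))" using N by simp
          finally have "9 ^ N * exp (- (real m / 100)) \<le> exp (3 * (real m / 400)) * exp (- (real m / 100))"
            by (intro mult_right_mono) auto
          also have "\<dots> = exp (- (real m / 400))" unfolding exp_add[symmetric] by simp
          finally show ?thesis using elim(2) by linarith
        qed
        ultimately show False using p0 by linarith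
      qed
      moreover have "real m / 800 * sqrt (real m) \<le> real N * sqrt (real m)"
        using N m by (intro mult_right_mono) auto
      moreover have "real m powr (3/2) = real m * sqrt (real m)"
        using m powr_add[of "real m" 1 "1/2"] by (simp add: powr_half_sqrt)
      ultimately show "real m powr (3/2) / 3200 \<le> real D" by simp
    qed
  qed
qed

section \<open>The certificate function at the zero input\<close>

lemma low_degree_eq_zero_input: "low_degree n n (\<lambda>x. \<Prod>i<n. 1 - of_bool (x i))"
proof -
  have "low_degree n (card {..<n} * 1) (\<lambda>x. \<Prod>i<n. 1 - of_bool (x i))"
    by (intro low_degree_prod low_degree_diff low_degree_const low_degree_var) auto
  then show ?thesis by simp
qed

text \<open>The indicator of the zero input is an admissible polynomial, so the minimum in
  \<open>bdeg\<close> ranges over a nonempty set and \<open>LeastI\<close> provides a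
  minimiser.\<close>

lemma bdeg_cert_zero_input_witness:
  assumes "dom f \<subseteq> cube n"
  obtains P where "poly_vars P \<subseteq> {..<n}" "total_degree P = bdeg n (cert_fun f (zero_input n))"
    "eval_at P (zero_input n) = 1"
    "\<And>y. y \<in> dom f \<Longrightarrow> f y \<noteq> f (zero_input n) \<Longrightarrow> eval_at P y = 0"
    "\<And>x. x \<in> cube n \<Longrightarrow> eval_at P x \<in> {0..1}"
proof -
  let ?g = "cert_fun f (zero_input n)"
  let ?R = "\<lambda>d. \<exists>P. poly_vars P \<subseteq> {..<n} \<and> multilinear P \<and> total_degree P = d \<and>
     (\<forall>x\<in>dom ?g. eval_at P x = of_bool (the (?g x))) \<and> (\<forall>x\<in>cube n. eval_at P x \<in> {0..1})"
  have dom: "y \<in> cube n" if "y \<in> dom ?g" for y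
    using that subsetD[OF assms, of y] by (auto simp: cert_fun_def split: if_splits)
  obtain P where P: "poly_vars P \<subseteq> {..<n}" "multilinear P" "eval_at P = (\<lambda>x. \<Prod>i<n. 1 - of_bool (x i))"
    using low_degree_imp_rpoly[OF low_degree_eq_zero_input] by metis
  have e: "eval_at P x = of_bool (x = zero_input n)" if "x \<in> cube n" for x
  proof (cases "x = zero_input n")
    case False
    then obtain i where "i < n" "x i" using eq_zero_input[OF \<open>x \<in> cube n\<close>] by blast
    then have "(\<Prod>i<n. 1 - of_bool (x i)) = (0::real)" by (intro prod_zero) auto
    with False show ?thesis using fun_cong[OF P(3), of x] by simp
  next
    case True
    then show ?thesis using fun_cong[OF P(3), of x] by (simp add: zero_input_def)
  qed
  have "eval_at P x = of_bool (the (?g x))" if "x \<in> dom ?g" for x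
    using e[OF dom[OF that]] that by (auto simp: cert_fun_def split: if_splits)
  then have "?R (total_degree P)"
    using P(1,2) e by (intro exI[of _ P]) auto
  then have "?R (LEAST d. ?R d)" by (rule LeastI[of ?R])
  then obtain P where P: "poly_vars P \<subseteq> {..<n}" "total_degree P = bdeg n ?g"
    "\<forall>x\<in>dom ?g. eval_at P x = of_bool (the (?g x))" "\<forall>x\<in>cube n. eval_at P x \<in> {0..1}"
    unfolding bdeg_def by blast
  show ?thesis
  proof (rule that[of P])
    have "zero_input n \<in> dom ?g" by (simp add: cert_fun_def domIff)
    then show "eval_at P (zero_input n) = 1" using P(3) by (simp add: cert_fun_def)
    fix y assume "y \<in> dom f" "f y \<noteq> f (zero_input n)"
    then have "?g y = Some False" by (auto simp: cert_fun_def)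
    then show "eval_at P y = 0" using P(3) by (metis domI of_bool_eq(1) option.sel)
  qed (use P in auto)
qed

text \<open>On the cube an optimal polynomial lies between 0 and the indicator of
  \<open>no_single_row\<close>, because it vanishes where the function differs from its value at the
  zero input. Averaging preserves both bounds and yields the \<open>p\<close> of
  \<open>eventually_degree_ge\<close>.\<close>

lemma eventually_bdeg_cert_grid_fun_ge:
  "eventually (\<lambda>m. real m powr (3/2) / 3200 \<le>
     real (bdeg (m\<^sup>2) (cert_fun (grid_fun m) (zero_input (m\<^sup>2))))) sequentially"
  using eventually_degree_ge
proof eventually_elim
  case (elim m)
  define n where "n = m\<^sup>2"
  define z where "z = zero_input n"
  obtain P where P: "poly_vars P \<subseteq> {..<n}" "total_degree P = bdeg n (cert_fun (grid_fun m) z)"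
    "eval_at P z = 1"
    "\<And>y. y \<in> dom (grid_fun m) \<Longrightarrow> grid_fun m y \<noteq> grid_fun m z \<Longrightarrow> eval_at P y = 0"
    "\<And>x. x \<in> cube n \<Longrightarrow> eval_at P x \<in> {0..1}"
    using bdeg_cert_zero_input_witness[of "grid_fun m" n] unfolding z_def n_def by auto
  have z: "no_single_row m z" "z \<in> cube n"
    using no_single_row_zero_input by (auto simp: z_def n_def)
  have le: "eval_at P x \<le> of_bool (no_single_row m x)" if "x \<in> cube n" for x
  proof (cases "no_single_row m x")
    case False
    then have "grid_fun m x \<noteq> grid_fun m z" using that z by (simp add: grid_fun_def n_def)
    then show ?thesis using P(4)[of x] that False by (simp add: n_def)
  qed (use P(5)[OF that] in auto)
  obtain p :: "real poly" where p: "Polynomial.degree p \<le> total_degree P"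
    "\<And>s. poly p s = (\<Sum>x\<in>cube n. bernoulli_weight n (\<lambda>_. s) x * eval_at P x)"
    by (rule low_degree_average[OF low_degree_eval_at[OF P(1) order_refl], where A = UNIV])
      (simp only: UNIV_I if_True)
  \<comment> \<open>At bias 0 all the weight sits on the zero input.\<close>
  have "poly p 0 = 1"
  proof -
    have "bernoulli_weight n (\<lambda>_. 0) x * eval_at P x = 0" if x: "x \<in> cube n - {z}" for x
    proof -
      obtain i where "i < n" "x i" using x eq_zero_input z_def by blast
      then show ?thesis unfolding bernoulli_weight_def by (auto intro!: prod_zero)
    qed
    then have "(\<Sum>x\<in>cube n - {z}. bernoulli_weight n (\<lambda>_. 0) x * eval_at P x) = 0"
      by (intro sum.neutral) blast
    then have "poly p 0 = bernoulli_weight n (\<lambda>_. 0) z * eval_at P z"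
      unfolding p(2) using z by (subst sum.remove[of _ z]) simp_all
    also have "\<dots> = 1"
      unfolding P(3) by (simp add: bernoulli_weight_def z_def zero_input_def)
    finally show ?thesis .
  qed
  moreover have "0 \<le> poly p s \<and> poly p s \<le> 1 \<and> poly p s \<le> (1 - real m * s * (1 - s) ^ (m - 1)) ^ m"
    if s: "s \<in> {0..1}" for s
  proof (intro conjI)
    have w: "0 \<le> bernoulli_weight n (\<lambda>_. s) x" for x
      using s by (intro bernoulli_weight_nonneg) auto
    show "0 \<le> poly p s"
      unfolding p(2) using w P(5) by (intro sum_nonneg mult_nonneg_nonneg) auto
    have "poly p s \<le> (\<Sum>x\<in>cube n. bernoulli_weight n (\<lambda>_. s) x * 1)"
      unfolding p(2) using w P(5) by (intro sum_mono mult_left_mono) auto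
    then show "poly p s \<le> 1" by (simp add: sum_bernoulli_weight)
    have "poly p s \<le> (\<Sum>x\<in>cube n. bernoulli_weight n (\<lambda>_. s) x * of_bool (no_single_row m x))"
      unfolding p(2) using w le by (intro sum_mono mult_left_mono) auto
    also have "\<dots> = (1 - real m * s * (1 - s) ^ (m - 1)) ^ m"
      unfolding n_def by (rule sum_bernoulli_weight_no_single_row)
    finally show "poly p s \<le> (1 - real m * s * (1 - s) ^ (m - 1)) ^ m" .
  qed
  ultimately have "real m powr (3/2) / 3200 \<le> real (total_degree P)"
    using elim p(1) by blast
  then show ?case unfolding P(2) z_def n_def .
qed

theorem theorem10:
  "\<exists>f :: nat \<Rightarrow> (nat \<Rightarrow> bool) \<rightharpoonup> bool.
     (\<forall>m>0. dom (f m) = cube (m\<^sup>2) \<and> rdeg (m\<^sup>2) (f m) = m) \<and>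
     (\<exists>k::nat. (\<lambda>m. real (cert_measure (bdeg (m\<^sup>2)) (f m))) \<in>
        \<Omega>(\<lambda>m. real m powr (3/2) / ln (real m) ^ k))"
proof (intro exI[of _ grid_fun] conjI allI impI exI[of _ 0])
  fix m :: nat
  show "dom (grid_fun m) = cube (m\<^sup>2)" by simp
  show "rdeg (m\<^sup>2) (grid_fun m) = m" by (rule rdeg_grid_fun)
next
  \<comment> \<open>The certificate measure is a maximum over all inputs, so the zero input alone
    bounds it from below.\<close>
  have "bdeg (m\<^sup>2) (cert_fun (grid_fun m) (zero_input (m\<^sup>2))) \<le> cert_measure (bdeg (m\<^sup>2)) (grid_fun m)" for m
    unfolding cert_measure_def by (intro Max_ge) auto
  then have le: "real (bdeg (m\<^sup>2) (cert_fun (grid_fun m) (zero_input (m\<^sup>2)))) \<le>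
      real (cert_measure (bdeg (m\<^sup>2)) (grid_fun m))" for m
    by simp
  \<comment> \<open>With \<open>k = 0\<close> the logarithmic factor is 1: the bound holds without
    any polylogarithmic loss.\<close>
  show "(\<lambda>m. real (cert_measure (bdeg (m\<^sup>2)) (grid_fun m))) \<in> \<Omega>(\<lambda>m. real m powr (3/2) / ln (real m) ^ 0)"
  proof (rule landau_omega.bigI[of "1/3200"])
    show "eventually (\<lambda>m. 1/3200 * norm (real m powr (3/2) / ln (real m) ^ 0) \<le>
        norm (real (cert_measure (bdeg (m\<^sup>2)) (grid_fun m)))) sequentially"
      using eventually_bdeg_cert_grid_fun_ge
      by eventually_elim (use le in \<open>auto intro: order_trans\<close>)
  qed simp
qed

end
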